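(* Let $p$ be a prime with $p\equiv 3 \pmod 4$ and let $\mathbb{F}_p$ be the field with $p$ elements. For $K\in\mathbb{F}_p$ let $C_K=\{(u,v)\in\mathbb{F}_p^2 : u^2+v^2=K\}$ be the circle with center $(0,0)$ and quadrance $K$ (so $|C_0|=1$ and $|C_i|=p+1$ for $i\neq 0$). For $i,j,k\in\mathbb{F}_p$ let $$N_{ij}^k=\#\{(a,b)\in C_i\times C_j : a+b\in C_k\},\qquad n_{ij}^k=\frac{N_{ij}^k}{|C_i|\,|C_j|}.$$ Let $i,j\in\mathbb{F}_p$ be nonzero, let $k\in\mathbb{F}_p$, and put $V=ij-\frac{(k-i-j)^2}{4}$. Then: (i) if $V$ is not a square in $\mathbb{F}_p$, then $N_{ij}^k=0$ and $n_{ij}^k=0$; (ii) if $V=0$, then $N_{ij}^k=|C_i|=p+1$ and $n_{ij}^k=\frac{1}{p+1}$; (iii) otherwise (i.e. $V$ is a nonzero square), $N_{ij}^k=2|C_i|=2(p+1)$ and $n_{ij}^k=\frac{2}{p+1}$.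
   Context: Addition of points in $\mathbb{F}_p^2$ is coordinatewise. $N_{ij}^k$ counts the ways of reaching a point of $C_k$ from the origin by first translating by an element of $C_i$ and then by an element of $C_j$. *)

theory Defs
  imports
    Complex_Main
    "HOL-Library.Cardinality"
    "HOL-Library.Product_Plus"
    "HOL-Computational_Algebra.Nth_Powers"
    "HOL-Number_Theory.Cong"
begin

text \<open>
  The field with \<open>p\<close> elements is rendered as an arbitrary type of sort \<open>{field, finite}\<close>
  whose cardinality is the prime \<open>p\<close>. Addition of points is the coordinatewise addition
  on pairs from \<^theory>\<open>HOL-Library.Product_Plus\<close>.
\<close>

definition circle :: "'a::field \<Rightarrow> ('a \<times> 'a) set" where
  "circle K = {(u, v). u\<^sup>2 + v\<^sup>2 = K}"

definition N_count :: "'a::field \<Rightarrow> 'a \<Rightarrow> 'a \<Rightarrow> nat" where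
  "N_count i j k = card {(a, b). a \<in> circle i \<and> b \<in> circle j \<and> a + b \<in> circle k}"

definition n_coeff :: "'a::field \<Rightarrow> 'a \<Rightarrow> 'a \<Rightarrow> real" where
  "n_coeff i j k = real (N_count i j k) / (real (card (circle i)) * real (card (circle j)))"

end

theory Submission
  imports Defs "HOL-Number_Theory.Residues"
begin

text \<open>
  Identify \<open>(u, v)\<close> with \<open>u + v \<iota>\<close>, where \<open>\<iota>\<^sup>2 = -1\<close>; the quadrance is then a multiplicative norm, and it
  is anisotropic because \<open>-1\<close> is not a square when \<open>p \<equiv> 3 (mod 4)\<close>. By pigeonhole every element is a
  sum of two squares, so all circles of nonzero quadrance are translates of the unit circle under
  multiplication, and counting the \<open>p\<^sup>2\<close> points of the plane gives each of them \<open>p + 1\<close> points.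
  For \<open>a \<in> C\<^sub>i\<close> and \<open>b \<in> C\<^sub>j\<close> the condition \<open>a + b \<in> C\<^sub>k\<close> says \<open>a \<cdot> b = (k - i - j) / 2\<close>, and the
  identity \<open>(a \<cdot> b)\<^sup>2 + (a \<times> b)\<^sup>2 = ij\<close> then says \<open>(a \<times> b)\<^sup>2 = V\<close>. As \<open>b\<close> is determined by
  \<open>a\<close>, \<open>a \<cdot> b\<close> and \<open>a \<times> b\<close>, the count is \<open>|C\<^sub>i|\<close> times the number of square roots of \<open>V\<close>.
\<close>

text \<open>Stated in the library only for the class \<open>finite_field\<close>, of which a type of sort
  \<open>{field, finite}\<close> need not be an instance.\<close>
lemma power_card_minus_one_eq_one:
  fixes x :: "'a::{field, finite}"
  assumes "x \<noteq> 0"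
  shows "x ^ (CARD('a) - 1) = 1"
proof -
  let ?S = "UNIV - {0::'a}"
  have "bij_betw ((*) x) ?S ?S"
    using assms by (intro bij_betwI[where g = "\<lambda>y. y / x"]) auto
  then have "(\<Prod>y\<in>?S. y) = (\<Prod>y\<in>?S. x * y)"
    by (rule prod.reindex_bij_betw[symmetric])
  also have "\<dots> = x ^ card ?S * (\<Prod>y\<in>?S. y)"
    by (simp add: prod.distrib)
  finally show ?thesis
    by (simp add: card_Diff_singleton)
qed

lemma two_neq_zero_if_odd_card:
  assumes "odd (CARD('a::{field, finite}))"
  shows "(2::'a) \<noteq> 0"
proof
  assume "(2::'a) = 0"
  then have "CHAR('a) dvd 2"
    by (metis of_nat_eq_0_iff_char_dvd of_nat_numeral)
  moreover have "CHAR('a) \<noteq> 1" by simp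
  ultimately have "CHAR('a) = 2"
    using two_is_prime_nat by (auto simp: prime_nat_iff)
  then show False
    using CHAR_dvd_CARD[where ?'a = 'a] assms by simp
qed

section \<open>Anisotropy of the quadrance\<close>

text \<open>Let q = 4n + 3 be the size of the field. A square root x of -1 would give x^(q - 1) =
  (-1)^(2n + 1) = -1, against Fermat's x^(q - 1) = 1, since 1 and -1 differ when q is odd.\<close>

lemma square_neq_minus_one:
  fixes x :: "'a::{field, finite}"
  assumes "[CARD('a) = 3] (mod 4)"
  shows "x\<^sup>2 \<noteq> -1"
proof
  assume x: "x\<^sup>2 = -1"
  have "CARD('a) mod 4 = 3" using assms by (simp add: cong_def)
  then obtain n where n: "CARD('a) = 4 * n + 3"
    using mult_div_mod_eq[of 4 "CARD('a)"] by metis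
  have "x \<noteq> 0" using x by auto
  then have "1 = x ^ (CARD('a) - 1)"
    by (rule power_card_minus_one_eq_one[symmetric])
  also have "CARD('a) - 1 = 2 * (2 * n + 1)"
    using n by simp
  also have "x ^ (2 * (2 * n + 1)) = -1"
    unfolding power_mult x by simp
  finally have "(2::'a) = 0"
    by (metis add.right_inverse one_add_one)
  moreover have "odd (CARD('a))" using n by simp
  ultimately show False
    using two_neq_zero_if_odd_card by blast
qed

text \<open>If v were nonzero, u / v would be a square root of -1.\<close>

lemma sum_two_squares_eq_0_iff:
  fixes u v :: "'a::{field, finite}"
  assumes "[CARD('a) = 3] (mod 4)"
  shows "u\<^sup>2 + v\<^sup>2 = 0 \<longleftrightarrow> u = 0 \<and> v = 0"
proof
  assume h: "u\<^sup>2 + v\<^sup>2 = 0"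
  have "v = 0"
  proof (rule ccontr)
    assume v: "v \<noteq> 0"
    have "u\<^sup>2 = - v\<^sup>2" using h by (simp add: eq_neg_iff_add_eq_0)
    then have "(u / v)\<^sup>2 = -1"
      using v by (simp add: power_divide)
    then show False using square_neq_minus_one[OF assms] by blast
  qed
  then show "u = 0 \<and> v = 0" using h by simp
qed simp

section \<open>Sizes of circles\<close>

text \<open>Squaring is at most two-to-one, so the squares fill at least half of the field, and so
  do the values \<open>m - v\<^sup>2\<close>. Odd cardinality makes both more than half, hence they
  meet.\<close>

lemma circle_nonempty:
  fixes m :: "'a::{field, finite}"
  assumes "odd (CARD('a))"
  shows "circle m \<noteq> {}"
proof -
  let ?S = "range (\<lambda>u::'a. u\<^sup>2)" and ?T = "range (\<lambda>v::'a. m - v\<^sup>2)"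
  have fibre: "card {u::'a. u\<^sup>2 = s} \<le> 2" for s
  proof (cases "\<exists>t. t\<^sup>2 = s")
    case True
    then obtain t where "t\<^sup>2 = s" by blast
    then have "{u. u\<^sup>2 = s} \<subseteq> {t, -t}" by (auto simp: power2_eq_iff)
    then have "card {u. u\<^sup>2 = s} \<le> card {t, -t}" by (intro card_mono) auto
    also have "\<dots> \<le> 2" by (simp add: card_insert_if)
    finally show ?thesis .
  qed simp
  have "CARD('a) = card (\<Union>s\<in>?S. {u. u\<^sup>2 = s})"
    by (rule arg_cong[where f = card]) auto
  also have "\<dots> \<le> (\<Sum>s\<in>?S. card {u. u\<^sup>2 = s})"
    by (rule card_UN_le) simp
  also have "\<dots> \<le> (\<Sum>s\<in>?S. 2)"
    by (rule sum_mono) (rule fibre)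
  finally have "CARD('a) \<le> 2 * card ?S" by simp
  moreover have "CARD('a) \<noteq> 2 * card ?S" using assms by auto
  moreover have "card ?T = card ?S"
  proof -
    have "?T = (\<lambda>s. m - s) ` ?S" by auto
    then show ?thesis by (simp add: card_image inj_on_def)
  qed
  ultimately have "card ?S + card ?T > CARD('a)" by simp
  moreover have "card (?S \<union> ?T) \<le> CARD('a)" by (rule card_mono) auto
  moreover have "card (?S \<union> ?T) = card ?S + card ?T" if "?S \<inter> ?T = {}"
    using that by (intro card_Un_disjoint) auto
  ultimately have "?S \<inter> ?T \<noteq> {}" by linarith
  then obtain u v where "u\<^sup>2 = m - v\<^sup>2" by auto
  then have "(u, v) \<in> circle m" by (simp add: circle_def)
  then show ?thesis by blast
qed

lemma card_circle_eq_unit_circle: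
  fixes m :: "'a::{field, finite}"
  assumes "odd (CARD('a))" and "m \<noteq> 0"
  shows "card (circle m) = card (circle (1::'a))"
proof -
  obtain r s where rs: "r\<^sup>2 + s\<^sup>2 = m"
    using circle_nonempty[OF assms(1), of m] by (auto simp: circle_def)
  \<comment> \<open>\<open>f\<close> multiplies by r + s\<iota>, an element of norm m;
    \<open>g\<close> multiplies by its conjugate and divides by m.\<close>
  define f where "f = (\<lambda>(u, v). (r * u - s * v, s * u + r * v))"
  define g where "g = (\<lambda>(u, v). ((r * u + s * v) / m, (r * v - s * u) / m))"
  have gf: "g (f z) = z" for z
  proof -
    obtain u v where z: "z = (u, v)" by (cases z)
    have "r * (r * u - s * v) + s * (s * u + r * v) = (r\<^sup>2 + s\<^sup>2) * u"
      "r * (s * u + r * v) - s * (r * u - s * v) = (r\<^sup>2 + s\<^sup>2) * v"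
      by (simp_all add: algebra_simps power2_eq_square)
    then show ?thesis
      using assms(2) by (simp add: z f_def g_def rs)
  qed
  have fg: "f (g z) = z" for z
  proof -
    obtain u v where z: "z = (u, v)" by (cases z)
    have "r * (r * u + s * v) - s * (r * v - s * u) = (r\<^sup>2 + s\<^sup>2) * u"
      "s * (r * u + s * v) + r * (r * v - s * u) = (r\<^sup>2 + s\<^sup>2) * v"
      by (simp_all add: algebra_simps power2_eq_square)
    then show ?thesis
      using assms(2) by (simp add: z f_def g_def rs flip: diff_divide_distrib add_divide_distrib)
  qed
  have norm_f: "(r * u - s * v)\<^sup>2 + (s * u + r * v)\<^sup>2 = m * (u\<^sup>2 + v\<^sup>2)" for u v
    unfolding rs[symmetric] by (simp add: algebra_simps power2_eq_square)
  have f_iff: "f z \<in> circle m \<longleftrightarrow> z \<in> circle 1" for z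
    using assms(2) by (cases z) (simp add: f_def circle_def norm_f)
  have "bij_betw f (circle 1) (circle m)"
    \<comment> \<open>That \<open>g\<close> lands in the unit circle is \<open>f_iff\<close> read
      backwards at \<open>g z\<close>, as \<open>f (g z) = z\<close>.\<close>
    by (rule bij_betwI[where g = g]) (auto simp: f_iff gf fg simp flip: f_iff)
  then show ?thesis by (simp add: bij_betw_same_card)
qed

lemma card_circle_zero:
  assumes "[CARD('a::{field, finite}) = 3] (mod 4)"
  shows "card (circle (0::'a)) = 1"
proof -
  have "circle (0::'a) = {(0, 0)}"
    by (auto simp: circle_def sum_two_squares_eq_0_iff[OF assms])
  then show ?thesis by simp
qed

lemma odd_if_cong_3_mod_4:
  fixes n :: nat
  assumes "[n = 3] (mod 4)"
  shows "odd n"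
  using assms unfolding cong_def by presburger

lemma card_circle:
  fixes m :: "'a::{field, finite}"
  assumes "[CARD('a) = 3] (mod 4)" and "m \<noteq> 0"
  shows "card (circle m) = CARD('a) + 1"
proof -
  let ?q = "CARD('a)" and ?c = "card (circle (1::'a))"
  have odd: "odd ?q" using assms(1) by (rule odd_if_cong_3_mod_4)
  have q: "?q > 1"
    using odd assms(1) by (cases "?q = 1") (auto simp: cong_def elim: oddE)
  have "?q * ?q = card (\<Union>K::'a. circle K)"
  proof -
    have "(\<Union>K::'a. circle K) = UNIV" by (auto simp: circle_def)
    then show ?thesis by (simp add: card_cartesian_product flip: UNIV_Times_UNIV)
  qed
  also have "\<dots> = (\<Sum>K\<in>UNIV. card (circle (K::'a)))"
    by (rule card_UN_disjoint) (auto simp: circle_def)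
  also have "\<dots> = card (circle (0::'a)) + (\<Sum>K\<in>UNIV - {0}. card (circle (K::'a)))"
    by (rule sum.remove) auto
  also have "\<dots> = 1 + (\<Sum>K\<in>UNIV - {0::'a}. ?c)"
    unfolding card_circle_zero[OF assms(1)]
    by (intro arg_cong[where f = "(+) 1"] sum.cong refl card_circle_eq_unit_circle[OF odd]) simp
  finally have eq: "?q * ?q = 1 + (?q - 1) * ?c"
    by (simp add: card_Diff_singleton)
  \<comment> \<open>Writing q = n + 1 removes the truncated subtraction: the count becomes n c = n
    (n + 2), and n can be cancelled because q > 1.\<close>
  obtain n where n: "?q = Suc n" "n > 0" using q by (cases ?q) auto
  have "n * ?c = n * (n + 2)" using eq unfolding n by simp
  then have "?c = n + 2" using n(2) by (simp only: mult_cancel1) simp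
  then show ?thesis
    using card_circle_eq_unit_circle[OF odd assms(2)] n by simp
qed

section \<open>Pairs of points with prescribed dot product\<close>

lemma N_count_eq_card_circle_times_card_roots:
  fixes i j k :: "'a::{field, finite}"
  assumes "(2::'a) \<noteq> 0" and "i \<noteq> 0"
  shows "N_count i j k = card (circle i) * card {w. w\<^sup>2 = i * j - (k - i - j)\<^sup>2 / 4}"
proof -
  define c where "c = (k - i - j) / 2"
  let ?W = "{w. w\<^sup>2 = i * j - (k - i - j)\<^sup>2 / 4}"
  let ?P = "{(a, b). a \<in> circle i \<and> b \<in> circle j \<and> a + b \<in> circle k}"
  have "2 * c = k - i - j" using assms(1) unfolding c_def by (metis nonzero_mult_div_cancel_left times_divide_eq_right)
  then have k: "k = i + j + 2 * c" by simp
  have W: "?W = {w. w\<^sup>2 = i * j - c\<^sup>2}"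
    by (simp add: c_def power_divide)
  \<comment> \<open>The conjugate of a times b is c + w\<iota>, with c the dot and w the cross
    product. As a has norm i, this gives b = a (c + w\<iota>) / i, which \<open>f\<close> computes;
    \<open>g\<close> recovers w.\<close>
  define f where "f = (\<lambda>((x, y), w). ((x, y), ((x * c - y * w) / i, (y * c + x * w) / i)))"
  define g where "g = (\<lambda>((x, y), (u, v)). ((x, y), x * v - y * u :: 'a))"
  have P: "((x, y), (u, v)) \<in> ?P \<longleftrightarrow> x\<^sup>2 + y\<^sup>2 = i \<and> u\<^sup>2 + v\<^sup>2 = j \<and> x * u + y * v = c" for x y u v
  proof -
    have "(x + u)\<^sup>2 + (y + v)\<^sup>2 = (x\<^sup>2 + y\<^sup>2) + (u\<^sup>2 + v\<^sup>2) + 2 * (x * u + y * v)"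
      by (simp add: algebra_simps power2_eq_square)
    moreover have "2 * (x * u + y * v) = 2 * c \<longleftrightarrow> x * u + y * v = c"
      using assms(1) by (simp only: mult_cancel_left) simp
    ultimately show ?thesis by (auto simp: circle_def k simp del: mult_cancel_left distrib_left_numeral)
  qed
  have "bij_betw f (circle i \<times> ?W) ?P"
  proof (rule bij_betw_byWitness[where f' = g])
    show "\<forall>z\<in>circle i \<times> ?W. g (f z) = z"
    proof safe
      fix x y w assume "(x, y) \<in> circle i"
      then have i: "x\<^sup>2 + y\<^sup>2 = i" by (simp add: circle_def)
      have "x * (y * c + x * w) - y * (x * c - y * w) = (x\<^sup>2 + y\<^sup>2) * w"
        by (simp add: algebra_simps power2_eq_square)
      then show "g (f ((x, y), w)) = ((x, y), w)"
        using assms(2) by (simp add: f_def g_def i flip: diff_divide_distrib)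
    qed
    show "\<forall>z\<in>?P. f (g z) = z"
    proof
      fix z assume z: "z \<in> ?P"
      obtain x y u v where xy: "z = ((x, y), (u, v))" by (metis surj_pair)
      have h: "x\<^sup>2 + y\<^sup>2 = i" "x * u + y * v = c" using z unfolding xy P by auto
      have "x * c - y * (x * v - y * u) = i * u" "y * c + x * (x * v - y * u) = i * v"
        unfolding h[symmetric] by (simp_all add: algebra_simps power2_eq_square)
      then show "f (g z) = z" using assms(2) by (simp add: xy f_def g_def)
    qed
    show "f ` (circle i \<times> ?W) \<subseteq> ?P"
    proof (rule image_subsetI)
      fix z assume z: "z \<in> circle i \<times> ?W"
      obtain x y w where xy: "z = ((x, y), w)" by (metis surj_pair)
      have i: "x\<^sup>2 + y\<^sup>2 = i" and w: "w\<^sup>2 = i * j - c\<^sup>2"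
        using z unfolding W by (simp_all add: xy circle_def)
      \<comment> \<open>Multiplicativity of the norm: c + w\<iota> has norm ij, so dividing by
        i\<iota>-free scalar i leaves norm j.\<close>
      have "(x * c - y * w)\<^sup>2 + (y * c + x * w)\<^sup>2 = (x\<^sup>2 + y\<^sup>2) * (c\<^sup>2 + w\<^sup>2)"
        by (simp add: algebra_simps power2_eq_square)
      also have "\<dots> = i\<^sup>2 * j" unfolding i w by (simp add: power2_eq_square)
      finally have 1: "((x * c - y * w) / i)\<^sup>2 + ((y * c + x * w) / i)\<^sup>2 = j"
        using assms(2) by (simp add: power_divide flip: add_divide_distrib)
      have "x * (x * c - y * w) + y * (y * c + x * w) = (x\<^sup>2 + y\<^sup>2) * c"
        by (simp add: algebra_simps power2_eq_square)
      then have 2: "x * ((x * c - y * w) / i) + y * ((y * c + x * w) / i) = c"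
        using assms(2) by (simp add: i flip: add_divide_distrib)
      show "f z \<in> ?P"
        unfolding xy f_def prod.case P using i 1 2 by blast
    qed
    show "g ` ?P \<subseteq> circle i \<times> ?W"
    proof (rule image_subsetI)
      fix z assume z: "z \<in> ?P"
      obtain x y u v where xy: "z = ((x, y), (u, v))" by (metis surj_pair)
      have h: "x\<^sup>2 + y\<^sup>2 = i" "u\<^sup>2 + v\<^sup>2 = j" "x * u + y * v = c" using z unfolding xy P by auto
      have "(x * v - y * u)\<^sup>2 = i * j - c\<^sup>2"
        unfolding h[symmetric] by (simp add: algebra_simps power2_eq_square)
      then show "g z \<in> circle i \<times> ?W"
        unfolding W by (simp add: xy g_def circle_def h)
    qed
  qed
  then have "card ?P = card (circle i \<times> ?W)" by (simp add: bij_betw_same_card)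
  then show ?thesis by (simp add: N_count_def card_cartesian_product)
qed

text \<open>The roots of V = \<open>t\<^sup>2\<close> are t and -t, which coincide only for t = 0
  because 2 is nonzero. The case V = 0 is tested first since 0 is itself a square.\<close>

lemma card_square_roots:
  fixes V :: "'a::field"
  assumes "(2::'a) \<noteq> 0"
  shows "card {w. w\<^sup>2 = V} = (if V = 0 then 1 else if is_square V then 2 else 0)"
proof (cases "is_square V")
  case True
  then obtain t where t: "V = t\<^sup>2" by (auto elim: is_nth_powerE)
  then have roots: "{w. w\<^sup>2 = V} = {t, -t}" by (auto simp: power2_eq_iff)
  have "t \<noteq> -t" if "t \<noteq> 0"
  proof
    assume "t = -t"
    then have "2 * t = 0" by (metis add.right_inverse mult_2)
    then show False using assms that by simp
  qed
  then show ?thesis using True t roots by auto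
next
  case False
  then have "{w. w\<^sup>2 = V} = {}" and "V \<noteq> 0" by (auto simp: is_nth_power_def)
  then show ?thesis using False by simp
qed

theorem theorem1:
  fixes p :: nat and i j k V :: "'a::{field, finite}"
  assumes "prime p" and "[p = 3] (mod 4)" and "CARD('a) = p"
    and "i \<noteq> 0" and "j \<noteq> 0"
    and "V = i * j - (k - i - j)\<^sup>2 / 4"
  shows "(card (circle (0::'a)) = 1 \<and> (\<forall>m::'a. m \<noteq> 0 \<longrightarrow> card (circle m) = p + 1)) \<and>
    (\<not> is_square V \<longrightarrow> N_count i j k = 0 \<and> n_coeff i j k = 0) \<and>
    (V = 0 \<longrightarrow> N_count i j k = card (circle i) \<and> card (circle i) = p + 1 \<and>
       n_coeff i j k = 1 / (real p + 1)) \<and>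
    (is_square V \<and> V \<noteq> 0 \<longrightarrow>
       N_count i j k = 2 * card (circle i) \<and> 2 * card (circle i) = 2 * (p + 1) \<and>
       n_coeff i j k = 2 / (real p + 1))"
proof -
  have p3: "[CARD('a) = 3] (mod 4)" using assms(2,3) by simp
  then have two: "(2::'a) \<noteq> 0"
    by (intro two_neq_zero_if_odd_card odd_if_cong_3_mod_4)
  have circ: "card (circle m) = p + 1" if "m \<noteq> 0" for m :: 'a
    using card_circle[OF p3 that] assms(3) by simp
  define r :: nat where "r = (if V = 0 then 1 else if is_square V then 2 else 0)"
  have N: "N_count i j k = (p + 1) * r"
    unfolding N_count_eq_card_circle_times_card_roots[OF two assms(4)] assms(6)[symmetric]
      card_square_roots[OF two] circ[OF assms(4)] r_def ..
  \<comment> \<open>Both circles have p + 1 points, and one factor p + 1 cancels.\<close>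
  have n: "n_coeff i j k = real r / (real p + 1)"
    unfolding n_coeff_def N circ[OF assms(4)] circ[OF assms(5)] of_nat_mult
    by (subst mult_divide_mult_cancel_left) simp_all
  have "V \<noteq> 0" if "\<not> is_square V" using that by auto
  then show ?thesis
    using N n circ card_circle_zero[OF p3] assms(4) by (auto simp: r_def)
qed

end
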